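(* Let $\Gamma$ be a signed graph of order $n \ge 2$. Then $\eta(\Gamma) = n-2$ (equivalently, $r(\Gamma)=2$) if and only if $\Gamma$ is a balanced complete bipartite signed graph together with some (possibly zero) isolated vertices.
   Context: A signed graph $\Gamma=(G,\sigma)$ consists of a finite simple graph $G=(V,E)$ (its underlying graph) and a map $\sigma:E\to\{+,-\}$ (identified with $\{+1,-1\}$). Its order is $|V|$. Its adjacency matrix is the symmetric matrix $A(\Gamma)$ whose $(i,j)$ entry is $\sigma(v_iv_j)$ if $v_iv_j\in E$ and $0$ otherwise. The nullity $\eta(\Gamma)$ is the multiplicity of $0$ as an eigenvalue of $A(\Gamma)$, and the rank $r(\Gamma)$ is the rank of $A(\Gamma)$; thus $\eta(\Gamma)+r(\Gamma)=n$ when $\Gamma$ has order $n$. The sign of a cycle is the product of the signs of its edges; a cycle is positive or negative according to its sign. A signed graph is balanced if all its cycles are positive, and unbalanced otherwise. A complete bipartite signed graph is one whose underlying graph is complete bipartite with two nonempty parts. *)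

theory Defs
  imports
    Jordan_Normal_Form.Char_Poly
    Jordan_Normal_Form.DL_Rank
begin

(* The value of esign outside the edge set is irrelevant. *)
record 'v signed_graph =
  verts :: "'v set"
  edges :: "'v set set"
  esign :: "'v set \<Rightarrow> int"

definition is_signed_graph :: "'v signed_graph \<Rightarrow> bool" where
  "is_signed_graph \<Gamma> \<longleftrightarrow>
     finite (verts \<Gamma>) \<and>
     (\<forall>e \<in> edges \<Gamma>. e \<subseteq> verts \<Gamma> \<and> card e = 2) \<and>
     (\<forall>e \<in> edges \<Gamma>. esign \<Gamma> e \<in> {1, -1})"

definition vertex_enum :: "'v signed_graph \<Rightarrow> 'v list \<Rightarrow> bool" where
  "vertex_enum \<Gamma> vs \<longleftrightarrow> distinct vs \<and> set vs = verts \<Gamma>"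

definition adj_mat :: "'v signed_graph \<Rightarrow> 'v list \<Rightarrow> real mat" where
  "adj_mat \<Gamma> vs = mat (length vs) (length vs)
     (\<lambda>(i, j). if {vs ! i, vs ! j} \<in> edges \<Gamma> then of_int (esign \<Gamma> {vs ! i, vs ! j}) else 0)"

(* Algebraic multiplicity of the eigenvalue 0; it is 0 when 0 is not an eigenvalue. *)
definition nullity :: "'v signed_graph \<Rightarrow> 'v list \<Rightarrow> nat" where
  "nullity \<Gamma> vs = Polynomial.order 0 (char_poly (adj_mat \<Gamma> vs))"

definition sg_rank :: "'v signed_graph \<Rightarrow> 'v list \<Rightarrow> nat" where
  "sg_rank \<Gamma> vs = vec_space.rank (length vs) (adj_mat \<Gamma> vs)"

(* A cycle is given by its vertices in cyclic order; the edges below include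
   the closing edge from the last vertex back to the first. *)
definition cycle_edges :: "'v list \<Rightarrow> 'v set list" where
  "cycle_edges c = map2 (\<lambda>u v. {u, v}) c (rotate1 c)"

definition is_cycle :: "'v signed_graph \<Rightarrow> 'v list \<Rightarrow> bool" where
  "is_cycle \<Gamma> c \<longleftrightarrow>
     length c \<ge> 3 \<and> distinct c \<and> set c \<subseteq> verts \<Gamma> \<and> set (cycle_edges c) \<subseteq> edges \<Gamma>"

definition cycle_sign :: "'v signed_graph \<Rightarrow> 'v list \<Rightarrow> int" where
  "cycle_sign \<Gamma> c = (\<Prod>e\<leftarrow>cycle_edges c. esign \<Gamma> e)"

definition balanced :: "'v signed_graph \<Rightarrow> bool" where
  "balanced \<Gamma> \<longleftrightarrow> (\<forall>c. is_cycle \<Gamma> c \<longrightarrow> cycle_sign \<Gamma> c = 1)"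

definition complete_bipartite :: "'v signed_graph \<Rightarrow> bool" where
  "complete_bipartite \<Gamma> \<longleftrightarrow>
     (\<exists>X Y. X \<noteq> {} \<and> Y \<noteq> {} \<and> X \<inter> Y = {} \<and> verts \<Gamma> = X \<union> Y \<and>
            edges \<Gamma> = {{x, y} | x y. x \<in> X \<and> y \<in> Y})"

definition add_isolated :: "'v signed_graph \<Rightarrow> 'v set \<Rightarrow> 'v signed_graph" where
  "add_isolated H I = H\<lparr>verts := verts H \<union> I\<rparr>"

end

theory Submission
  imports
    Defs
    Jordan_Normal_Form.Jordan_Normal_Form_Existence
    Jordan_Normal_Form.Jordan_Normal_Form_Uniqueness
begin

text \<open>
  The adjacency matrix \<open>A\<close> is real symmetric, so its characteristic polynomial splits over the reals
  and all positive powers of \<open>A\<close> have the same kernel; hence the algebraic multiplicity of \<open>0\<close> is the kernel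
  dimension, and nullity and rank add up to \<open>n\<close>.

  For an edge \<open>uv\<close> of sign \<open>s\<close>, the columns of \<open>u\<close> and \<open>v\<close> are independent, so the rank is \<open>2\<close> iff
  every column is a combination of these two. The rows of \<open>u\<close> and \<open>v\<close> determine the coefficients, so
  this means \<open>a x w = s (a v w a u x + a u w a v x)\<close> for all \<open>x\<close> and \<open>w\<close>. The case \<open>x = w\<close> shows that
  \<open>u\<close> and \<open>v\<close> have no common neighbour, so the edges are exactly the pairs in \<open>N v \<times> N u\<close>, and the
  sign of an edge is a product of vertex signs, which cancel around every cycle. Conversely, in a
  balanced complete bipartite graph the identity says that the cycles \<open>u w x v\<close> are positive.
\<close>

section \<open>Rank, kernel dimension and a criterion for rank two\<close>

lemma rank_plus_kernel_dim:
  fixes A :: "'a :: field mat"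
  assumes A: "A \<in> carrier_mat nr nc"
  shows "vec_space.rank nr A + kernel_dim A = nc"
proof -
  interpret V: vec_space "TYPE('a)" nc .
  interpret W: vec_space "TYPE('a)" nr .
  interpret L: linear_map class_ring "module_vec TYPE('a) nc" "module_vec TYPE('a) nr" "(*\<^sub>v) A"
  proof -
    have "(*\<^sub>v) A \<in> LinearCombinations.module_hom class_ring (module_vec TYPE('a) nc) (module_vec TYPE('a) nr)"
      using A by (auto simp: LinearCombinations.module_hom_def module_vec_simps
          mult_add_distrib_mat_vec mult_mat_vec)
    then show "linear_map class_ring (module_vec TYPE('a) nc) (module_vec TYPE('a) nr) ((*\<^sub>v) A)"
      by (intro linear_map.intro mod_hom.intro mod_hom_axioms.intro V.vectorspace_axioms W.vectorspace_axioms
          V.module_axioms W.module_axioms)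
  qed
  have im: "L.im = W.span (set (cols A))"
    using W.col_space_eq[OF A] A unfolding W.col_space_def L.im_def by (auto simp: module_vec_simps)
  have ker: "L.ker = mat_kernel A"
    using A unfolding L.ker_def mat_kernel_def by (auto simp: module_vec_simps)
  have "kernel_dim A = vectorspace.dim class_ring ((module_vec TYPE('a) nc)\<lparr>carrier := mat_kernel A\<rparr>)"
    using A unfolding kernel_dim_def by auto
  then show ?thesis
    using L.rank_nullity[OF V.fin_dim] unfolding im ker W.rank_def V.dim_is_n by simp
qed

text \<open>The zero pattern in rows \<open>p\<close> and \<open>q\<close> makes columns
  \<open>i\<close> and \<open>j\<close> independent, so the rank is 2 exactly when these two columns
  span all the others.\<close>

lemma (in vec_space) rank_eq_2_iff:
  fixes A :: "'a mat"
  assumes A: "A \<in> carrier_mat n nc"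
    and ij: "i < nc" "j < nc" and pq: "p < n" "q < n"
    and i: "A $$ (p, i) = 0" "A $$ (q, i) \<noteq> 0"
    and j: "A $$ (p, j) \<noteq> 0" "A $$ (q, j) = 0"
  shows "rank A = 2 \<longleftrightarrow>
    (\<forall>k < nc. \<exists>a b. \<forall>r < n. A $$ (r, k) = a * A $$ (r, i) + b * A $$ (r, j))"
proof -
  let ?S = "{col A i, col A j}"
  have carr: "set (cols A) \<subseteq> carrier_vec n"
    using A cols_dim by blast
  have S: "?S \<subseteq> set (cols A)"
    using A ij by (auto simp: cols_def)
  have SC: "?S \<subseteq> carrier_vec n" using A by auto
  \<comment> \<open>The columns differ in row \<open>p\<close>. Hence \<open>?S\<close> has two
    elements, and a linear combination over it has two separate coefficients.\<close>
  have ne: "col A i \<noteq> col A j"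
    using A ij pq i j by (metis carrier_matD index_col)
  have indpt: "lin_indpt ?S"
  proof (rule finite_lin_indpt2)
    fix a :: "'a vec \<Rightarrow> 'a" assume lc: "lincomb a ?S = 0\<^sub>v n"
    have "a (col A i) * A $$ (r, i) + a (col A j) * A $$ (r, j) = 0" if "r < n" for r
      using lincomb_index[OF that SC, of a] lc that ne A ij by simp
    \<comment> \<open>Row \<open>p\<close> isolates the coefficient of column \<open>j\<close>, row
      \<open>q\<close> that of column \<open>i\<close>.\<close>
    from this[of p] this[of q] show "\<forall>v\<in>?S. a v = 0"
      using pq i j by auto
  qed (use SC in auto)
  have in_span: "col A k \<in> span ?S \<longleftrightarrow> (\<exists>a b. \<forall>r < n. A $$ (r, k) = a * A $$ (r, i) + b * A $$ (r, j))"
    if k: "k < nc" for k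
  proof
    assume "col A k \<in> span ?S"
    then obtain a where "lincomb a ?S = col A k"
      using finite_in_span[of ?S "col A k"] SC by auto
    then show "\<exists>a b. \<forall>r < n. A $$ (r, k) = a * A $$ (r, i) + b * A $$ (r, j)"
      using lincomb_index[OF _ SC, of _ a] ne A ij k
      by (intro exI[of _ "a (col A i)"] exI[of _ "a (col A j)"]) simp
  next
    assume "\<exists>a b. \<forall>r < n. A $$ (r, k) = a * A $$ (r, i) + b * A $$ (r, j)"
    then obtain a b where ab: "\<And>r. r < n \<Longrightarrow> A $$ (r, k) = a * A $$ (r, i) + b * A $$ (r, j)"
      by blast
    let ?f = "\<lambda>v. if v = col A i then a else b"
    have "col A k = lincomb ?f ?S"
    proof (rule eq_vecI)
      show "dim_vec (col A k) = dim_vec (lincomb ?f ?S)"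
        using A lincomb_closed[OF SC, of ?f] by simp
      then show "col A k $ r = lincomb ?f ?S $ r" if "r < dim_vec (lincomb ?f ?S)" for r
        using that A ij k ne lincomb_index[OF _ SC, of r ?f] ab by simp
    qed
    then show "col A k \<in> span ?S"
      unfolding span_def by auto
  qed
  have "rank A = 2 \<longleftrightarrow> (\<forall>k < nc. col A k \<in> span ?S)"
  proof
    assume r: "rank A = 2"
    show "\<forall>k < nc. col A k \<in> span ?S"
    proof (intro allI impI, rule ccontr)
      \<comment> \<open>A column outside the span would extend \<open>?S\<close> to three
        independent columns.\<close>
      fix k assume k: "k < nc" and nin: "col A k \<notin> span ?S"
      have notin: "col A k \<notin> ?S"
        using nin in_own_span[OF SC] by blast
      have "lin_indpt (?S \<union> {col A k})"
        using lin_dep_iff_in_span[OF _ indpt _ notin] SC A k nin by simp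
      from rank_ge_card_indpt[OF A _ this] have "card (?S \<union> {col A k}) \<le> rank A"
        using S A k by (auto simp: cols_def)
      then show False using r ne notin by simp
    qed
  next
    assume sp: "\<forall>k < nc. col A k \<in> span ?S"
    \<comment> \<open>The rank is the size of any maximal independent set of columns; every column
      outside \<open>?S\<close> is dependent on \<open>?S\<close>, so \<open>?S\<close> is such a
      set.\<close>
    have "maximal ?S (\<lambda>T. T \<subseteq> set (cols A) \<and> lin_indpt T)"
      unfolding maximal_def
    proof (intro conjI allI impI S indpt)
      fix T assume T: "?S \<subseteq> T \<and> T \<subseteq> set (cols A) \<and> lin_indpt T"
      have "v \<in> ?S" if v: "v \<in> T" for v
      proof (rule ccontr)
        assume nv: "v \<notin> ?S"
        have "v \<in> span ?S" using sp v T A by (auto simp: cols_def)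
        then have "lin_dep (?S \<union> {v})"
          using lin_dep_iff_in_span[OF _ indpt _ nv] SC carr v T by auto
        then show False
          using T v subset_li_is_li[of T "?S \<union> {v}"] by auto
      qed
      then show "T = ?S" using T by auto
    qed
    from rank_card_indpt[OF A this] show "rank A = 2" using ne by simp
  qed
  then show ?thesis using in_span by simp
qed

section \<open>Real symmetric matrices and the multiplicity of the eigenvalue 0\<close>

text \<open>The scalar product here is bilinear, without conjugation; the generality covers both a
  real matrix and its complexification.\<close>

lemma sym_scalar_prod_swap:
  fixes A :: "'a :: comm_semiring_0 mat"
  assumes A: "A \<in> carrier_mat n n" and sym: "A\<^sup>T = A"
    and v: "v \<in> carrier_vec n" and w: "w \<in> carrier_vec n"
  shows "(A *\<^sub>v v) \<bullet> w = v \<bullet> (A *\<^sub>v w)"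
  using transpose_vec_mult_scalar[OF A w v] sym A v w
  by (metis comm_scalar_prod mult_mat_vec_carrier)

text \<open>Since \<open>A\<close> is real, \<open>conjugate v\<close> is an eigenvector for
  \<open>cnj k\<close>. Moving \<open>A\<close> across the product of \<open>v\<close> and
  \<open>conjugate v\<close> then equates \<open>k\<close> and \<open>cnj k\<close> times the
  nonzero number \<open>v \<bullet>c v\<close>.\<close>

lemma sym_eigenvalue_real:
  fixes A :: "real mat"
  assumes A: "A \<in> carrier_mat n n" and sym: "A\<^sup>T = A"
    and ev: "eigenvalue (map_mat complex_of_real A) k"
  shows "k \<in> \<real>"
proof -
  let ?A = "map_mat complex_of_real A"
  have cA: "?A \<in> carrier_mat n n" using A by simp
  have symA: "?A\<^sup>T = ?A"
    using sym by (metis map_mat_transpose)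
  from ev obtain v where v: "v \<in> carrier_vec n" "v \<noteq> 0\<^sub>v n" "?A *\<^sub>v v = k \<cdot>\<^sub>v v"
    using A unfolding eigenvalue_def eigenvector_def by auto
  have cv: "conjugate v \<in> carrier_vec n" using v by simp
  have "?A *\<^sub>v conjugate v = conjugate (?A *\<^sub>v v)"
    using A v(1) by (intro eq_vecI) (auto simp: scalar_prod_def sum_conjugate conjugate_dist_mul)
  also have "\<dots> = cnj k \<cdot>\<^sub>v conjugate v"
    unfolding v(3) by (simp add: conjugate_smult_vec)
  finally have cjv: "?A *\<^sub>v conjugate v = cnj k \<cdot>\<^sub>v conjugate v" .
  have "k * (v \<bullet>c v) = (?A *\<^sub>v v) \<bullet>c v"
    unfolding v(3) using v(1) by simp
  also have "\<dots> = v \<bullet> (?A *\<^sub>v conjugate v)"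
    by (rule sym_scalar_prod_swap[OF cA symA v(1) cv])
  also have "\<dots> = cnj k * (v \<bullet>c v)"
    unfolding cjv using v(1) by simp
  finally have "k = cnj k"
    using v(1,2) by simp
  then show ?thesis
    by (metis Reals_cnj_iff)
qed

text \<open>The complex roots are eigenvalues, hence real, so the complex factorization is the image
  of a real one. Splitting over the reals is what yields a real Jordan normal form.\<close>

lemma sym_char_poly_splits:
  fixes A :: "real mat"
  assumes A: "A \<in> carrier_mat n n" and sym: "A\<^sup>T = A"
  shows "\<exists>as. char_poly A = (\<Prod>a\<leftarrow>as. [:- a, 1:])"
proof -
  let ?A = "map_mat complex_of_real A"
  have cA: "?A \<in> carrier_mat n n" using A by simp
  obtain as where as: "char_poly ?A = (\<Prod>a\<leftarrow>as. [:- a, 1:])"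
    using char_poly_factorized[OF cA] by blast
  have real: "complex_of_real (Re a) = a" if "a \<in> set as" for a
  proof -
    have "poly (char_poly ?A) a = 0"
      unfolding as poly_prod_list using that by (auto simp: image_iff)
    then have "eigenvalue ?A a"
      using eigenvalue_root_char_poly[OF cA] by simp
    then show ?thesis
      using sym_eigenvalue_real[OF A sym] by (simp add: of_real_Re)
  qed
  interpret P: map_poly_inj_comm_ring_hom complex_of_real ..
  have "map_poly complex_of_real (char_poly A) = char_poly ?A"
    by (rule of_real_hom.char_poly_hom[OF A, symmetric])
  also have "\<dots> = (\<Prod>a\<leftarrow>as. [:- a, 1:])"
    by (rule as)
  also have "\<dots> = (\<Prod>a\<leftarrow>map Re as. map_poly complex_of_real [:- a, 1:])"
    using real by (auto intro!: arg_cong[where f = prod_list] simp: hom_distribs)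
  also have "\<dots> = map_poly complex_of_real (\<Prod>a\<leftarrow>map Re as. [:- a, 1:])"
    by (simp add: P.hom_prod_list o_def)
  finally show ?thesis
    by (metis P.injectivity)
qed

text \<open>If \<open>A\<close> kills \<open>A v\<close>, then by symmetry the product of
  \<open>A v\<close> with itself is 0, which over the reals forces \<open>A v\<close> to vanish. The
  exponent \<open>Suc k\<close> excludes the identity matrix.\<close>

lemma sym_mat_kernel_pow:
  fixes A :: "real mat"
  assumes A: "A \<in> carrier_mat n n" and sym: "A\<^sup>T = A"
  shows "mat_kernel (A ^\<^sub>m Suc k) = mat_kernel A"
proof (induction k)
  case 0
  then show ?case using A by simp
next
  case (Suc k)
  have pow: "A ^\<^sub>m m \<in> carrier_mat n n" for m
    using A by simp
  have "v \<in> mat_kernel (A ^\<^sub>m Suc (Suc k)) \<longleftrightarrow> v \<in> mat_kernel A" if v: "v \<in> carrier_vec n" for v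
  proof -
    have Av: "A *\<^sub>v v \<in> carrier_vec n" using A v by simp
    have "v \<in> mat_kernel (A ^\<^sub>m Suc (Suc k)) \<longleftrightarrow> A *\<^sub>v v \<in> mat_kernel (A ^\<^sub>m Suc k)"
      using assoc_mult_mat_vec[OF pow[of "Suc k"] A v] Av v
      unfolding mat_kernel[OF pow] by simp
    also have "\<dots> \<longleftrightarrow> A *\<^sub>v (A *\<^sub>v v) = 0\<^sub>v n"
      unfolding Suc.IH mat_kernel[OF A] using Av by simp
    also have "\<dots> \<longleftrightarrow> A *\<^sub>v v = 0\<^sub>v n"
    proof
      assume "A *\<^sub>v (A *\<^sub>v v) = 0\<^sub>v n"
      then have "(A *\<^sub>v v) \<bullet> (A *\<^sub>v v) = 0"
        using sym_scalar_prod_swap[OF A sym v Av] v by simp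
      then show "A *\<^sub>v v = 0\<^sub>v n"
        using conjugate_square_eq_0_vec[OF Av] by simp
    next
      assume "A *\<^sub>v v = 0\<^sub>v n"
      then show "A *\<^sub>v (A *\<^sub>v v) = 0\<^sub>v n"
        using A by (auto intro!: eq_vecI)
    qed
    finally show ?thesis
      unfolding mat_kernel[OF A] using v by simp
  qed
  then show ?case
    using mat_kernel_carrier[OF pow] mat_kernel_carrier[OF A] by blast
qed

text \<open>The algebraic multiplicity is the total size of the Jordan blocks for 0, which is the
  kernel dimension of a high power of \<open>A\<close>; that kernel is already the kernel of
  \<open>A\<close>.\<close>

lemma sym_order_0_char_poly:
  fixes A :: "real mat"
  assumes A: "A \<in> carrier_mat n n" and sym: "A\<^sup>T = A"
  shows "Polynomial.order 0 (char_poly A) = kernel_dim A"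
proof -
  obtain n_as where jnf: "jordan_nf A n_as"
    using sym_char_poly_splits[OF A sym] jordan_nf_exists[OF A] by blast
  have cm: "char_matrix A 0 = A"
    using A unfolding char_matrix_def by auto
  \<comment> \<open>\<open>N\<close> bounds every block size, so the minimum with
    \<open>Suc N\<close> changes nothing; the successor keeps the exponent positive.\<close>
  define N where "N = sum_list (map fst n_as)"
  have le: "m \<le> Suc N" if "(m, e) \<in> set n_as" for m e
    using member_le_sum_list[of m "map fst n_as"] that unfolding N_def by force
  have "Polynomial.order 0 (char_poly A) = (\<Sum>m\<leftarrow>map fst [(m, e)\<leftarrow>n_as . e = 0]. m)"
    unfolding jordan_nf_order[OF jnf] by (simp add: case_prod_unfold)
  also have "\<dots> = (\<Sum>m\<leftarrow>map fst [(m, e)\<leftarrow>n_as . e = 0]. min (Suc N) m)"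
    using le by (intro arg_cong[where f = sum_list] map_cong) (auto simp: min_absorb2)
  also have "\<dots> = kernel_dim (A ^\<^sub>m Suc N)"
    unfolding dim_gen_eigenspace[OF jnf, symmetric] dim_gen_eigenspace_def cm ..
  also have "\<dots> = kernel_dim A"
    unfolding kernel_dim_def sym_mat_kernel_pow[OF A sym] using A by simp
  finally show ?thesis .
qed

section \<open>Signed adjacency entries\<close>

text \<open>Indexing by vertices makes the entries independent of the enumeration \<open>vs\<close>,
  and integer values keep the sign algebra free of casts.\<close>

definition adj :: "'v signed_graph \<Rightarrow> 'v \<Rightarrow> 'v \<Rightarrow> int" where
  "adj \<Gamma> x y = (if {x, y} \<in> edges \<Gamma> then esign \<Gamma> {x, y} else 0)"

lemma adj_commute: "adj \<Gamma> x y = adj \<Gamma> y x"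
  unfolding adj_def by (simp add: insert_commute)

lemma adj_mat_carrier: "adj_mat \<Gamma> vs \<in> carrier_mat (length vs) (length vs)"
  unfolding adj_mat_def by simp

lemma adj_mat_index:
  "i < length vs \<Longrightarrow> j < length vs \<Longrightarrow> adj_mat \<Gamma> vs $$ (i, j) = of_int (adj \<Gamma> (vs ! i) (vs ! j))"
  unfolding adj_mat_def adj_def by simp

lemma adj_mat_sym: "(adj_mat \<Gamma> vs)\<^sup>T = adj_mat \<Gamma> vs"
  using adj_mat_carrier[of \<Gamma> vs] by (intro eq_matI) (auto simp: adj_mat_index adj_commute)

lemma adj_self:
  assumes "is_signed_graph \<Gamma>"
  shows "adj \<Gamma> x x = 0"
  using assms unfolding is_signed_graph_def adj_def by force

lemma adj_eq_0_iff:
  assumes "is_signed_graph \<Gamma>"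
  shows "adj \<Gamma> x y = 0 \<longleftrightarrow> {x, y} \<notin> edges \<Gamma>"
  using assms unfolding is_signed_graph_def adj_def by force

lemma adj_square:
  assumes "is_signed_graph \<Gamma>" "{x, y} \<in> edges \<Gamma>"
  shows "adj \<Gamma> x y * adj \<Gamma> x y = 1"
  using assms unfolding is_signed_graph_def adj_def by force

section \<open>Balance from vertex signs\<close>

lemma prod_list_map2_mult:
  assumes "length xs = length ys"
  shows "prod_list (map2 (\<lambda>x y. f x * g y) xs ys) = prod_list (map f xs) * prod_list (map g ys :: 'a :: comm_monoid_mult list)"
  using assms by (induction rule: list_induct2) (simp_all add: ac_simps)

text \<open>Each vertex of a cycle lies on two of its edges, so its sign enters the product squared.
  The function \<open>f\<close> is a switching function that makes all edges positive.\<close>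

lemma balanced_if_potential:
  assumes edge: "\<And>x y. {x, y} \<in> edges H \<Longrightarrow> esign H {x, y} = f x * f y"
    and unit: "\<And>x. x \<in> verts H \<Longrightarrow> f x * f x = 1"
  shows "balanced H"
  unfolding balanced_def
proof (intro allI impI)
  fix c assume c: "is_cycle H c"
  have "cycle_sign H c = (\<Prod>(x, y)\<leftarrow>zip c (rotate1 c). f x * f y)"
    using c unfolding cycle_sign_def cycle_edges_def is_cycle_def
    by (auto intro!: arg_cong[where f = prod_list] edge simp: image_subset_iff)
  also have "\<dots> = prod_list (map f c) * prod_list (map f (rotate1 c))"
    by (simp add: prod_list_map2_mult)
  \<comment> \<open>The second endpoints are the first ones rotated, so both have the same
    product.\<close>
  also have "prod_list (map f (rotate1 c)) = prod_list (map f c)"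
    by (cases c) (simp_all add: mult.commute)
  also have "prod_list (map f c) * prod_list (map f c) = (\<Prod>x\<leftarrow>c. f x * f x)"
    by (induction c) (simp_all add: ac_simps)
  also have "\<dots> = (\<Prod>x\<leftarrow>c. 1)"
    using c unit unfolding is_cycle_def
    by (intro arg_cong[where f = prod_list] map_cong) auto
  finally show "cycle_sign H c = 1" by (simp add: map_replicate_const)
qed

section \<open>Rank two as an identity between adjacency entries\<close>

text \<open>Applies the rank criterion to the columns of \<open>u\<close> and \<open>v\<close>; rows
  \<open>u\<close> and \<open>v\<close> determine the coefficients, which eliminates the existential
  quantifiers.\<close>

lemma sg_rank_eq_2_iff:
  assumes G: "is_signed_graph \<Gamma>" and vs: "vertex_enum \<Gamma> vs" and uv: "{u, v} \<in> edges \<Gamma>"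
  shows "sg_rank \<Gamma> vs = 2 \<longleftrightarrow> (\<forall>x \<in> verts \<Gamma>. \<forall>w \<in> verts \<Gamma>.
    adj \<Gamma> x w = adj \<Gamma> u v * (adj \<Gamma> v w * adj \<Gamma> u x + adj \<Gamma> u w * adj \<Gamma> v x))"
    (is "_ \<longleftrightarrow> ?R")
proof -
  let ?A = "adj_mat \<Gamma> vs" and ?n = "length vs"
  have set: "set vs = verts \<Gamma>" using vs unfolding vertex_enum_def by simp
  have "u \<in> set vs" "v \<in> set vs"
    using G uv unfolding set is_signed_graph_def by auto
  then obtain i j where ij: "i < ?n" "j < ?n" "vs ! i = u" "vs ! j = v"
    by (auto simp: in_set_conv_nth)
  let ?s = "adj \<Gamma> u v"
  have s: "?s * ?s = 1" "?s \<noteq> 0"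
    using adj_square[OF G uv] by auto
  \<comment> \<open>On rows and columns \<open>u\<close>, \<open>v\<close> the matrix has zero
    diagonal, as there are no loops, and the nonzero sign \<open>?s\<close> elsewhere: the required
    zero pattern.\<close>
  have "sg_rank \<Gamma> vs = 2 \<longleftrightarrow> (\<forall>k < ?n. \<exists>a b. \<forall>r < ?n. ?A $$ (r, k) = a * ?A $$ (r, i) + b * ?A $$ (r, j))"
    unfolding sg_rank_def
    using s ij adj_self[OF G] adj_commute[of \<Gamma> v u]
    by (intro vec_space.rank_eq_2_iff[OF adj_mat_carrier, where i = i and j = j and p = i and q = j])
      (auto simp: adj_mat_index)
  also have "\<dots> \<longleftrightarrow> (\<forall>w \<in> set vs. \<exists>a b. \<forall>x \<in> set vs.
      real_of_int (adj \<Gamma> x w) = a * of_int (adj \<Gamma> x u) + b * of_int (adj \<Gamma> x v))"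
    using ij unfolding all_set_conv_all_nth by (simp add: adj_mat_index)
  also have "\<dots> \<longleftrightarrow> ?R"
  proof
    assume L: "\<forall>w \<in> set vs. \<exists>a b. \<forall>x \<in> set vs.
      real_of_int (adj \<Gamma> x w) = a * of_int (adj \<Gamma> x u) + b * of_int (adj \<Gamma> x v)"
    show ?R
    proof (intro ballI)
      fix x w assume x: "x \<in> verts \<Gamma>" and w: "w \<in> verts \<Gamma>"
      from L w obtain a b where ab: "\<And>x. x \<in> set vs \<Longrightarrow>
          real_of_int (adj \<Gamma> x w) = a * of_int (adj \<Gamma> x u) + b * of_int (adj \<Gamma> x v)"
        unfolding set by blast
      have rs: "real_of_int ?s * of_int ?s = 1"
        using s(1) by (metis of_int_1 of_int_mult)
      \<comment> \<open>Row \<open>u\<close> reads \<open>adj \<Gamma> u w = b * ?s\<close>, and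
        \<open>?s\<close> is its own inverse; row \<open>v\<close> gives \<open>a\<close>
        likewise.\<close>
      have b: "b = of_int ?s * of_int (adj \<Gamma> u w)"
        using ab[OF \<open>u \<in> set vs\<close>] rs adj_self[OF G] by (simp add: ac_simps)
      have a: "a = of_int ?s * of_int (adj \<Gamma> v w)"
        using ab[OF \<open>v \<in> set vs\<close>] rs adj_self[OF G] adj_commute[of \<Gamma> v u] by (simp add: ac_simps)
      have "real_of_int (adj \<Gamma> x w) = of_int (?s * (adj \<Gamma> v w * adj \<Gamma> u x + adj \<Gamma> u w * adj \<Gamma> v x))"
        using ab[of x] x unfolding set a b by (simp add: algebra_simps adj_commute[of \<Gamma> x])
      then show "adj \<Gamma> x w = ?s * (adj \<Gamma> v w * adj \<Gamma> u x + adj \<Gamma> u w * adj \<Gamma> v x)"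
        by (simp only: of_int_eq_iff)
    qed
  next
    assume R: ?R
    show "\<forall>w \<in> set vs. \<exists>a b. \<forall>x \<in> set vs.
      real_of_int (adj \<Gamma> x w) = a * of_int (adj \<Gamma> x u) + b * of_int (adj \<Gamma> x v)"
    proof
      fix w assume w: "w \<in> set vs"
      show "\<exists>a b. \<forall>x \<in> set vs.
        real_of_int (adj \<Gamma> x w) = a * of_int (adj \<Gamma> x u) + b * of_int (adj \<Gamma> x v)"
      proof (intro exI ballI)
        fix x assume "x \<in> set vs"
        then have "adj \<Gamma> x w = ?s * adj \<Gamma> v w * adj \<Gamma> x u + ?s * adj \<Gamma> u w * adj \<Gamma> x v"
          using R w unfolding set by (simp add: algebra_simps adj_commute[of \<Gamma> x])
        \<comment> \<open>This instantiates the open witnesses with the coefficients forced in the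
          other direction.\<close>
        then show "real_of_int (adj \<Gamma> x w) =
          of_int (?s * adj \<Gamma> v w) * of_int (adj \<Gamma> x u) + of_int (?s * adj \<Gamma> u w) * of_int (adj \<Gamma> x v)"
          by (metis of_int_add of_int_mult)
      qed
    qed
  qed
  finally show ?thesis .
qed

lemma sg_rank_no_edges:
  assumes "edges \<Gamma> = {}"
  shows "sg_rank \<Gamma> vs = 0"
proof -
  have "adj_mat \<Gamma> vs = 0\<^sub>m (length vs) (length vs)"
    unfolding adj_mat_def using assms by auto
  then show ?thesis
    unfolding sg_rank_def by (simp add: vec_space.rank_0I)
qed

section \<open>From the identity to balanced complete bipartite graphs and back\<close>

text \<open>The parts are the neighbourhoods of \<open>v\<close> and \<open>u\<close>; all remaining
  vertices are isolated. Every edge keeps exactly one summand of the identity, and that summand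
  factors into vertex signs.\<close>

lemma complete_bipartite_balanced_if_adj:
  assumes G: "is_signed_graph \<Gamma>" and uv: "{u, v} \<in> edges \<Gamma>"
    and adj: "\<And>x w. x \<in> verts \<Gamma> \<Longrightarrow> w \<in> verts \<Gamma> \<Longrightarrow>
      adj \<Gamma> x w = adj \<Gamma> u v * (adj \<Gamma> v w * adj \<Gamma> u x + adj \<Gamma> u w * adj \<Gamma> v x)"
  shows "\<exists>H I. is_signed_graph H \<and> complete_bipartite H \<and> balanced H \<and>
    finite I \<and> verts H \<inter> I = {} \<and> \<Gamma> = add_isolated H I"
proof -
  let ?s = "adj \<Gamma> u v"
  have fin: "finite (verts \<Gamma>)" and edge_verts: "\<And>x y. {x, y} \<in> edges \<Gamma> \<Longrightarrow> x \<in> verts \<Gamma> \<and> y \<in> verts \<Gamma>"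
    using G unfolding is_signed_graph_def by auto
  have s: "?s * ?s = 1" using adj_square[OF G uv] .
  define X where "X = {x. {v, x} \<in> edges \<Gamma>}"
  define Y where "Y = {y. {u, y} \<in> edges \<Gamma>}"
  have X: "adj \<Gamma> v x = 0 \<longleftrightarrow> x \<notin> X" and Y: "adj \<Gamma> u x = 0 \<longleftrightarrow> x \<notin> Y" for x
    unfolding X_def Y_def using adj_eq_0_iff[OF G] by auto
  have XY_verts: "X \<union> Y \<subseteq> verts \<Gamma>"
    unfolding X_def Y_def using edge_verts by auto
  have disj: "X \<inter> Y = {}"
  proof -
    \<comment> \<open>For \<open>x = w\<close> the left side vanishes and the right side is twice
      this product, up to the sign \<open>?s\<close>.\<close>
    have "adj \<Gamma> v w * adj \<Gamma> u w = 0" if "w \<in> verts \<Gamma>" for w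
      using adj[OF that that] adj_self[OF G, of w] s by auto
    then show ?thesis using X Y XY_verts by (auto simp: disjoint_iff)
  qed
  have XY: "adj \<Gamma> x y = ?s * (adj \<Gamma> u y * adj \<Gamma> v x)" if "x \<in> X" "y \<in> Y" for x y
  proof -
    have "x \<in> verts \<Gamma>" "y \<in> verts \<Gamma>" "adj \<Gamma> u x = 0"
      using that XY_verts disj Y[of x] by auto
    then show ?thesis using adj by simp
  qed
  have edge_cases: "x \<in> X \<and> y \<in> Y \<or> y \<in> X \<and> x \<in> Y" if "{x, y} \<in> edges \<Gamma>" for x y
  proof -
    have "adj \<Gamma> x y \<noteq> 0" "x \<in> verts \<Gamma>" "y \<in> verts \<Gamma>"
      using that edge_verts[OF that] adj_eq_0_iff[OF G, of x y] by auto
    \<comment> \<open>A nonzero entry needs a nonzero summand; the two summands are the two ways of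
      placing \<open>x\<close> and \<open>y\<close> in the parts.\<close>
    then have "adj \<Gamma> v y * adj \<Gamma> u x + adj \<Gamma> u y * adj \<Gamma> v x \<noteq> 0"
      using adj by (metis mult_zero_right)
    then show ?thesis
      using X Y by (metis add.right_neutral mult_zero_left mult_zero_right)
  qed
  have edge_XY: "{x, y} \<in> edges \<Gamma>" if "x \<in> X" "y \<in> Y" for x y
  proof -
    have "adj \<Gamma> u y \<noteq> 0" "adj \<Gamma> v x \<noteq> 0"
      using that X Y by auto
    moreover have "?s \<noteq> 0"
      using s by (metis mult_zero_left zero_neq_one)
    ultimately have "adj \<Gamma> x y \<noteq> 0"
      unfolding XY[OF that] by (metis mult_eq_0_iff)
    then show ?thesis using adj_eq_0_iff[OF G] by blast
  qed
  have edges: "edges \<Gamma> = {{x, y} | x y. x \<in> X \<and> y \<in> Y}"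
  proof (intro equalityI subsetI)
    fix e assume e: "e \<in> edges \<Gamma>"
    then obtain x y where "e = {x, y}"
      using G unfolding is_signed_graph_def by (metis card_2_iff)
    then show "e \<in> {{x, y} | x y. x \<in> X \<and> y \<in> Y}"
      using edge_cases e by blast
  qed (use edge_XY in auto)
  define H where "H = \<Gamma>\<lparr>verts := X \<union> Y\<rparr>"
  define I where "I = verts \<Gamma> - (X \<union> Y)"
  have "is_signed_graph H"
    unfolding is_signed_graph_def
  proof (intro conjI ballI)
    show "finite (verts H)" using fin XY_verts finite_subset unfolding H_def by auto
  next
    fix e assume e: "e \<in> edges H"
    then obtain x y where "e = {x, y}" "x \<in> X" "y \<in> Y"
      using edges unfolding H_def by auto
    then show "e \<subseteq> verts H" unfolding H_def by auto
    show "card e = 2" "esign H e \<in> {1, - 1}"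
      using e G unfolding H_def is_signed_graph_def by auto
  qed
  moreover have "complete_bipartite H"
    unfolding complete_bipartite_def
  proof (intro exI conjI)
    have "u \<in> X" "v \<in> Y"
      using uv unfolding X_def Y_def by (simp_all add: insert_commute)
    then show "X \<noteq> {}" "Y \<noteq> {}" by auto
    show "X \<inter> Y = {}" by (rule disj)
    show "verts H = X \<union> Y" "edges H = {{x, y} | x y. x \<in> X \<and> y \<in> Y}"
      unfolding H_def by (simp_all add: edges)
  qed
  moreover have "balanced H"
  proof (rule balanced_if_potential)
    \<comment> \<open>Read off from \<open>XY\<close>, with the factor \<open>?s\<close> charged to
      the vertices of \<open>Y\<close>.\<close>
    let ?f = "\<lambda>w. if w \<in> X then adj \<Gamma> v w else ?s * adj \<Gamma> u w"
    have "esign \<Gamma> {x, y} = ?f x * ?f y" if "x \<in> X" "y \<in> Y" for x y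
      using XY[OF that] edge_XY[OF that] that disj unfolding adj_def[of _ x y] by (auto simp: ac_simps)
    note XY_sign = this
    show "esign H {x, y} = ?f x * ?f y" if "{x, y} \<in> edges H" for x y
    proof -
      have "x \<in> X \<and> y \<in> Y \<or> y \<in> X \<and> x \<in> Y"
        using edge_cases[of x y] that unfolding H_def by simp
      then have "esign \<Gamma> {x, y} = ?f x * ?f y"
        using XY_sign[of x y] XY_sign[of y x] by (metis insert_commute mult.commute)
      then show ?thesis unfolding H_def by simp
    qed
    show "?f x * ?f x = 1" if "x \<in> verts H" for x
    proof (cases "x \<in> X")
      case True
      then show ?thesis using adj_square[OF G] unfolding X_def by auto
    next
      case False
      then have "adj \<Gamma> u x * adj \<Gamma> u x = 1"
        using that adj_square[OF G] unfolding H_def Y_def by auto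
      then have "(?s * ?s) * (adj \<Gamma> u x * adj \<Gamma> u x) = 1" using s by simp
      then show ?thesis using False by (simp add: ac_simps)
    qed
  qed
  moreover have "\<Gamma> = add_isolated H I"
    using XY_verts unfolding add_isolated_def H_def I_def by (cases \<Gamma>) auto
  moreover have "finite I" "verts H \<inter> I = {}"
    using fin unfolding H_def I_def by auto
  ultimately show ?thesis by blast
qed

text \<open>Any \<open>u\<close> and \<open>v\<close> from opposite parts work: across the parts the
  identity is the positivity of a 4-cycle, and elsewhere both sides are 0. Letting \<open>x\<close>
  and \<open>w\<close> range over the whole type lets the identity survive the addition of isolated
  vertices.\<close>

lemma adj_if_complete_bipartite_balanced:
  assumes H: "is_signed_graph H" "complete_bipartite H" "balanced H"
  shows "\<exists>u v. {u, v} \<in> edges H \<and> (\<forall>x w.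
      adj H x w = adj H u v * (adj H v w * adj H u x + adj H u w * adj H v x))"
proof -
  from H(2) obtain X Y where ne: "X \<noteq> {}" "Y \<noteq> {}" and disj: "X \<inter> Y = {}"
    and verts: "verts H = X \<union> Y" and edges: "edges H = {{x, y} | x y. x \<in> X \<and> y \<in> Y}"
    unfolding complete_bipartite_def by (elim exE conjE) (rule that)
  from ne obtain u v where u: "u \<in> X" and v: "v \<in> Y" by blast
  have edge_iff: "{x, y} \<in> edges H \<longleftrightarrow> x \<in> X \<and> y \<in> Y \<or> x \<in> Y \<and> y \<in> X" for x y
    unfolding edges by (auto simp: doubleton_eq_iff)
  have zero: "adj H x y = 0 \<longleftrightarrow> \<not> (x \<in> X \<and> y \<in> Y \<or> x \<in> Y \<and> y \<in> X)" for x y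
    using adj_eq_0_iff[OF H(1)] edge_iff by auto
  have sq: "adj H x y * adj H x y = 1" if "x \<in> X" "y \<in> Y" for x y
    using adj_square[OF H(1)] edge_iff that by auto
  have XY: "adj H x w = adj H u v * (adj H u w * adj H v x)" if x: "x \<in> X" and w: "w \<in> Y" for x w
  proof (cases "x = u \<or> w = v")
    \<comment> \<open>The 4-cycle degenerates here, and the identity reduces to the square of the
      sign of \<open>uv\<close> being 1.\<close>
    case True
    then have "adj H u v * (adj H u w * adj H v x) = adj H x w * (adj H u v * adj H u v)"
      by (auto simp: ac_simps adj_commute[of H v])
    then show ?thesis
      using sq[OF u v] by simp
  next
    case False
    have "is_cycle H [u, w, x, v]"
      unfolding is_cycle_def cycle_edges_def
      using False x w u v disj verts edge_iff by auto
    then have "cycle_sign H [u, w, x, v] = 1"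
      using H(3) unfolding balanced_def by blast
    then have "adj H u w * (adj H w x * (adj H x v * adj H v u)) = 1"
      using x w u v edge_iff unfolding cycle_sign_def cycle_edges_def adj_def by simp
    then have c: "adj H x w * (adj H u v * (adj H u w * adj H v x)) = 1"
      by (simp add: ac_simps adj_commute[of H w] adj_commute[of H v])
    \<comment> \<open>Multiplying by \<open>adj H x w\<close>, which is its own inverse, solves the
      cycle equation for it.\<close>
    then have "adj H x w * adj H x w * (adj H u v * (adj H u w * adj H v x)) = adj H x w"
      by (simp add: mult.assoc)
    then show ?thesis using sq[OF x w] by simp
  qed
  have "adj H x w = adj H u v * (adj H v w * adj H u x + adj H u w * adj H v x)" for x w
  proof -
    consider "x \<in> X" "w \<in> Y" | "x \<in> Y" "w \<in> X" | "\<not> (x \<in> X \<and> w \<in> Y \<or> x \<in> Y \<and> w \<in> X)"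
      by blast
    then show ?thesis
    proof cases
      case 1
      then have "adj H u x = 0" using zero u disj by auto
      then show ?thesis using XY[OF 1] by simp
    next
      case 2
      then have "adj H u w = 0" using zero u disj by auto
      then show ?thesis using XY[OF 2(2,1)] adj_commute[of H x w] by (simp add: ac_simps)
    next
      case 3
      \<comment> \<open>Neighbours of \<open>u\<close> lie in \<open>Y\<close> and those of
        \<open>v\<close> in \<open>X\<close>, so a nonzero product would put \<open>x\<close> and
        \<open>w\<close> in opposite parts.\<close>
      then have "adj H x w = 0" "adj H v w * adj H u x = 0" "adj H u w * adj H v x = 0"
        using zero u v disj by auto
      then show ?thesis by (simp only: add_0_right mult_zero_right)
    qed
  qed
  then show ?thesis using edge_iff u v by blast
qed

section \<open>The characterisation of nullity \<open>n - 2\<close>\<close>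

theorem theorem2p3:
  fixes \<Gamma> :: "'v signed_graph" and vs :: "'v list" and n :: nat
  assumes "is_signed_graph \<Gamma>"
    and "vertex_enum \<Gamma> vs"
    and "card (verts \<Gamma>) = n"
    and "n \<ge> 2"
  shows "(nullity \<Gamma> vs = n - 2 \<longleftrightarrow> sg_rank \<Gamma> vs = 2) \<and>
         (nullity \<Gamma> vs = n - 2 \<longleftrightarrow>
            (\<exists>H I. is_signed_graph H \<and> complete_bipartite H \<and> balanced H \<and>
                   finite I \<and> verts H \<inter> I = {} \<and> \<Gamma> = add_isolated H I))"
proof -
  let ?A = "adj_mat \<Gamma> vs"
  have len: "length vs = n"
    using assms(2,3) unfolding vertex_enum_def by (metis distinct_card)
  have "sg_rank \<Gamma> vs + nullity \<Gamma> vs = n"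
    using rank_plus_kernel_dim[OF adj_mat_carrier[of \<Gamma> vs]]
      sym_order_0_char_poly[OF adj_mat_carrier adj_mat_sym, of \<Gamma> vs]
    unfolding sg_rank_def nullity_def len by simp
  \<comment> \<open>The bound \<open>n \<ge> 2\<close> makes the truncated subtraction
    exact.\<close>
  then have nul: "nullity \<Gamma> vs = n - 2 \<longleftrightarrow> sg_rank \<Gamma> vs = 2"
    using assms(4) by linarith
  have "sg_rank \<Gamma> vs = 2 \<longleftrightarrow>
    (\<exists>H I. is_signed_graph H \<and> complete_bipartite H \<and> balanced H \<and>
      finite I \<and> verts H \<inter> I = {} \<and> \<Gamma> = add_isolated H I)" (is "_ \<longleftrightarrow> ?R")
  proof
    assume r: "sg_rank \<Gamma> vs = 2"
    then have "edges \<Gamma> \<noteq> {}"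
      using sg_rank_no_edges[of \<Gamma> vs] by auto
    then obtain u v where uv: "{u, v} \<in> edges \<Gamma>"
      using assms(1) unfolding is_signed_graph_def by (metis card_2_iff ex_in_conv)
    then show ?R
      using r sg_rank_eq_2_iff[OF assms(1,2) uv] complete_bipartite_balanced_if_adj[OF assms(1) uv] by blast
  next
    assume ?R
    then obtain H I where H: "is_signed_graph H" "complete_bipartite H" "balanced H"
      and \<Gamma>: "\<Gamma> = add_isolated H I" by blast
    \<comment> \<open>Isolated vertices change neither edges nor signs, so the identity for
      \<open>H\<close> is one for \<open>\<Gamma>\<close>.\<close>
    have "edges \<Gamma> = edges H" "adj \<Gamma> = adj H"
      unfolding \<Gamma> add_isolated_def by (auto simp: adj_def fun_eq_iff)
    then show "sg_rank \<Gamma> vs = 2"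
      using adj_if_complete_bipartite_balanced[OF H] sg_rank_eq_2_iff[OF assms(1,2)] by metis
  qed
  then show ?thesis using nul by blast
qed

end
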